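(* Let $k\ge1$, let $S_1,\dots,S_{k+1}$ be sets and $(\alpha_1,\dots,\alpha_{k+1})\in{}^{\ast}(S_1\times\dots\times S_{k+1})$. The following are equivalent: (1) $(\alpha_1,\dots,\alpha_{k+1})$ is a tensor $(k+1)$-ple; (2) for every $F=\{i_1<\dots<i_l\}\subseteq\{1,\dots,k+1\}$, $(\alpha_{i_1},\dots,\alpha_{i_l})$ is a tensor $l$-ple.
   Context: Work in a single superstructure model of nonstandard methods with star map $\ast$ satisfying transfer. For $\gamma\in{}^{\ast}Y$, $\mathfrak{U}_\gamma=\{A\subseteq Y\mid\gamma\in{}^{\ast}A\}$. For $\mathcal{U}_i\in\beta S_i$, $\mathcal{U}_1\otimes\dots\otimes\mathcal{U}_k$ is the ultrafilter on $S_1\times\dots\times S_k$ with $A\in\mathcal{U}_1\otimes\dots\otimes\mathcal{U}_k$ iff $\{s_1\in S_1\mid\{s_2\in S_2\mid\dots\{s_k\in S_k\mid(s_1,\dots,s_k)\in A\}\in\mathcal{U}_k\}\dots\}\in\mathcal{U}_1$. A tuple $(\alpha_1,\dots,\alpha_k)\in{}^{\ast}(S_1\times\dots\times S_k)$ is a tensor $k$-ple if $\mathfrak{U}_{(\alpha_1,\dots,\alpha_k)}=\mathfrak{U}_{\alpha_1}\otimes\dots\otimes\mathfrak{U}_{\alpha_k}$. *)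

theory Defs
  imports Main
begin

text \<open>Formulas of the language of set theory in which every quantifier is bounded;
  \<open>BAll i j \<phi>\<close> stands for \<open>\<forall>x\<^sub>i \<in> x\<^sub>j. \<phi>\<close>.\<close>

datatype bfm =
    Mem nat nat
  | Eq nat nat
  | Neg bfm
  | Conj bfm bfm
  | BAll nat nat bfm

primrec sat :: "('v \<Rightarrow> 'v \<Rightarrow> bool) \<Rightarrow> (nat \<Rightarrow> 'v) \<Rightarrow> bfm \<Rightarrow> bool" where
  "sat E e (Mem i j) \<longleftrightarrow> E (e i) (e j)"
| "sat E e (Eq i j) \<longleftrightarrow> e i = e j"
| "sat E e (Neg \<phi>) \<longleftrightarrow> \<not> sat E e \<phi>"
| "sat E e (Conj \<phi> \<psi>) \<longleftrightarrow> sat E e \<phi> \<and> sat E e \<psi>"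
| "sat E e (BAll i j \<phi>) \<longleftrightarrow> (\<forall>y. E y (e j) \<longrightarrow> sat E (e(i := y)) \<phi>)"

text \<open>For \<open>X\<close> a set of atoms in a type with membership relation \<open>E\<close>:
  \<open>V\<^sub>0(X) = X\<close> and \<open>V\<^sub>n\<^sub>+\<^sub>1(X) = V\<^sub>n(X) \<union> \<P>(V\<^sub>n(X))\<close>.\<close>

primrec level :: "'v set \<Rightarrow> ('v \<Rightarrow> 'v \<Rightarrow> bool) \<Rightarrow> nat \<Rightarrow> 'v set" where
  "level X E 0 = X"
| "level X E (Suc n) = level X E n \<union> {v. v \<notin> X \<and> {x. E x v} \<subseteq> level X E n}"

text \<open>The type \<open>'v\<close> with membership \<open>E\<close> is the superstructure \<open>V(X)\<close> (determined by \<open>X\<close> up to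
  isomorphism). It is axiomatized because the union of all finite levels over an
  arbitrary \<open>X\<close> cannot be constructed as a type in HOL.\<close>

locale superstructure =
  fixes X :: "'v set" and E :: "'v \<Rightarrow> 'v \<Rightarrow> bool"
  assumes atoms: "a \<in> X \<Longrightarrow> \<not> E x a"
    and extensional: "u \<notin> X \<Longrightarrow> v \<notin> X \<Longrightarrow> {x. E x u} = {x. E x v} \<Longrightarrow> u = v"
    and powerset: "A \<subseteq> level X E n \<Longrightarrow> \<exists>v. v \<notin> X \<and> {x. E x v} = A"
    and exhausted: "\<exists>n. v \<in> level X E n"
begin

text \<open>\<open>is_set A\<close>: the collection \<open>A\<close> is a set of the superstructure;
  \<open>as_elem A\<close> is then the element of \<open>V(X)\<close> that it is.\<close>

definition is_set :: "'v set \<Rightarrow> bool" where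
  "is_set A \<longleftrightarrow> (\<exists>n. A \<subseteq> level X E n)"

definition as_elem :: "'v set \<Rightarrow> 'v" where
  "as_elem A = (THE v. v \<notin> X \<and> {x. E x v} = A)"

definition pair :: "'v \<Rightarrow> 'v \<Rightarrow> 'v" where
  "pair a b = as_elem {as_elem {a}, as_elem {a, b}}"

fun tuple :: "'v list \<Rightarrow> 'v" where
  "tuple [] = as_elem {}"
| "tuple [a] = a"
| "tuple (a # b # as) = pair a (tuple (b # as))"

definition product :: "'v set list \<Rightarrow> 'v set" where
  "product Ss = tuple ` listset Ss"

text \<open>\<open>iterated [S\<^sub>1,\<dots>,S\<^sub>k] [U\<^sub>1,\<dots>,U\<^sub>k] P\<close> is
  \<open>{s\<^sub>1 \<in> S\<^sub>1. \<dots> {s\<^sub>k \<in> S\<^sub>k. P [s\<^sub>1,\<dots>,s\<^sub>k]} \<in> U\<^sub>k \<dots>} \<in> U\<^sub>1\<close>; only lists of equal length matter.\<close>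

fun iterated :: "'v set list \<Rightarrow> 'v set set list \<Rightarrow> ('v list \<Rightarrow> bool) \<Rightarrow> bool" where
  "iterated (S # Ss) (U # Us) P \<longleftrightarrow> {s \<in> S. iterated Ss Us (\<lambda>ss. P (s # ss))} \<in> U"
| "iterated _ _ P \<longleftrightarrow> P []"

definition tensor :: "'v set list \<Rightarrow> 'v set set list \<Rightarrow> 'v set set" where
  "tensor Ss Us = {A. A \<subseteq> product Ss \<and> iterated Ss Us (\<lambda>ss. tuple ss \<in> A)}"

end

locale single_superstructure_model = superstructure X E
  for X :: "'v set" and E :: "'v \<Rightarrow> 'v \<Rightarrow> bool" +
  fixes star :: "'v \<Rightarrow> 'v"
  assumes star_base: "star (as_elem X) = as_elem X"
    and transfer: "sat E e \<phi> \<longleftrightarrow> sat E (star \<circ> e) \<phi>"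
begin

definition star_set :: "'v set \<Rightarrow> 'v set" where
  "star_set A = {x. E x (star (as_elem A))}"

definition generated_ultrafilter :: "'v set \<Rightarrow> 'v \<Rightarrow> 'v set set" where
  "generated_ultrafilter Y \<gamma> = {A. A \<subseteq> Y \<and> \<gamma> \<in> star_set A}"

definition tensor_tuple :: "'v set list \<Rightarrow> 'v list \<Rightarrow> bool" where
  "tensor_tuple Ss \<alpha>s \<longleftrightarrow>
     length \<alpha>s = length Ss \<and>
     tuple \<alpha>s \<in> star_set (product Ss) \<and>
     generated_ultrafilter (product Ss) (tuple \<alpha>s) =
       tensor Ss (map2 generated_ultrafilter Ss \<alpha>s)"

end

end

theory Submission
  imports Defs "Jordan_Normal_Form.DL_Missing_Sublist"
begin

text \<open>The coordinate projection \<open>\<pi>\<^sub>F\<close> of tuples of a fixed length is definable by a bounded formula,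
  so transfer gives \<open>\<alpha> \<in> \<^sup>*(\<pi>\<^sub>F\<^sup>-\<^sup>1 A)\<close> iff \<open>\<pi>\<^sub>F \<alpha> \<in> \<^sup>*A\<close>. On the other side, membership of
  \<open>\<pi>\<^sub>F\<^sup>-\<^sup>1 A\<close> in the tensor product of ultrafilters reduces to membership of \<open>A\<close> in the tensor product
  over \<open>F\<close>, because a quantifier over a proper filter is vacuous when the matrix does not depend on
  its variable.\<close>

lemma length_of_listset: "xs \<in> listset Ss \<Longrightarrow> length xs = length Ss"
  by (induction Ss arbitrary: xs) (auto simp: set_Cons_def)

lemma nths_in_listset: "xs \<in> listset Ss \<Longrightarrow> nths xs F \<in> listset (nths Ss F)"
  by (induction Ss arbitrary: xs F) (auto simp: set_Cons_def nths_Cons)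

lemma ex_length_Suc_iff:
  "(\<exists>xs. length xs = Suc n \<and> P xs) \<longleftrightarrow> (\<exists>x xs. length xs = n \<and> P (x # xs))"
  unfolding length_Suc_conv by blast

lemma nths_eq_Nil_iff: "nths xs F = [] \<longleftrightarrow> F \<inter> {..<length xs} = {}"
  by (auto simp: set_nths simp flip: set_empty)

lemma nths_index_singleton: "i < length xs \<Longrightarrow> nths xs {i} = [xs ! i]"
  by (rule nths_only_one) auto

context superstructure
begin

subsection \<open>Sets, pairs and tuples of a superstructure\<close>

lemma level_mono: "m \<le> n \<Longrightarrow> level X E m \<subseteq> level X E n"
  by (induction n rule: dec_induct) auto

lemma
  assumes "is_set A"
  shows as_elem_notin_atoms: "as_elem A \<notin> X"
    and mem_as_elem_iff: "E x (as_elem A) \<longleftrightarrow> x \<in> A"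
proof -
  obtain v where v: "v \<notin> X \<and> {x. E x v} = A"
    using assms powerset unfolding is_set_def by blast
  have "as_elem A \<notin> X \<and> {x. E x (as_elem A)} = A"
    unfolding as_elem_def by (rule theI[where a = v]) (use v extensional in auto)
  then show "as_elem A \<notin> X" "E x (as_elem A) \<longleftrightarrow> x \<in> A" by auto
qed

lemma as_elem_eqI: "v \<notin> X \<Longrightarrow> is_set A \<Longrightarrow> (\<And>x. E x v \<longleftrightarrow> x \<in> A) \<Longrightarrow> v = as_elem A"
  by (rule extensional) (auto simp: as_elem_notin_atoms mem_as_elem_iff)

lemma as_elem_inject: "is_set A \<Longrightarrow> is_set B \<Longrightarrow> as_elem A = as_elem B \<longleftrightarrow> A = B"
  by (auto simp flip: mem_as_elem_iff)

lemma as_elem_in_level: "A \<subseteq> level X E n \<Longrightarrow> as_elem A \<in> level X E (Suc n)"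
  using as_elem_notin_atoms[of A] mem_as_elem_iff[of A] by (auto simp: is_set_def)

lemma is_set_subset: "is_set B \<Longrightarrow> A \<subseteq> B \<Longrightarrow> is_set A"
  unfolding is_set_def by blast

lemma is_set_empty: "is_set {}"
  by (simp add: is_set_def)

lemma is_set_atoms: "is_set X"
  unfolding is_set_def by (rule exI[of _ 0]) simp

lemma is_set_insert:
  assumes "is_set A"
  shows "is_set (insert a A)"
proof -
  obtain n m where "A \<subseteq> level X E n" "a \<in> level X E m"
    using assms exhausted unfolding is_set_def by blast
  then have "insert a A \<subseteq> level X E (max n m)"
    using level_mono[of n "max n m"] level_mono[of m "max n m"] by auto
  then show ?thesis unfolding is_set_def by blast
qed

lemma is_set_singleton: "is_set {a}"
  by (simp add: is_set_insert is_set_empty)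

lemma is_set_doubleton: "is_set {a, b}"
  by (simp add: is_set_insert is_set_empty)

lemma mem_doubleton_iff: "E x (as_elem {a, b}) \<longleftrightarrow> x = a \<or> x = b"
  by (simp add: mem_as_elem_iff is_set_doubleton)

lemma eq_doubleton_iff:
  "v = as_elem {a, b} \<longleftrightarrow> E a v \<and> E b v \<and> (\<forall>w. E w v \<longrightarrow> w = a \<or> w = b)" (is "_ \<longleftrightarrow> ?R")
proof
  assume ?R
  then have "v \<notin> X" using atoms by blast
  then show "v = as_elem {a, b}"
    by (rule as_elem_eqI) (use \<open>?R\<close> in \<open>auto simp: is_set_doubleton\<close>)
qed (simp add: mem_doubleton_iff)

lemma pair_eq_doubleton: "pair a b = as_elem {as_elem {a, a}, as_elem {a, b}}"
  by (simp add: pair_def)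

lemma pair_inject: "pair a b = pair c d \<longleftrightarrow> a = c \<and> b = d"
  by (auto simp: pair_def as_elem_inject is_set_singleton is_set_doubleton doubleton_eq_iff)

lemma pair_in_level:
  "a \<in> level X E n \<Longrightarrow> b \<in> level X E n \<Longrightarrow> pair a b \<in> level X E (Suc (Suc n))"
  unfolding pair_def by (intro as_elem_in_level insert_subsetI empty_subsetI)

lemma is_set_pairs:
  assumes "is_set A" "is_set B"
  shows "is_set {pair a b |a b. a \<in> A \<and> b \<in> B}"
proof -
  obtain m n where "A \<subseteq> level X E m" "B \<subseteq> level X E n"
    using assms unfolding is_set_def by blast
  then have "A \<subseteq> level X E (max m n)" "B \<subseteq> level X E (max m n)"
    using level_mono[of m "max m n"] level_mono[of n "max m n"] by auto
  then have "{pair a b |a b. a \<in> A \<and> b \<in> B} \<subseteq> level X E (Suc (Suc (max m n)))"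
    using pair_in_level by blast
  then show ?thesis unfolding is_set_def by blast
qed

lemma tuple_Cons: "xs \<noteq> [] \<Longrightarrow> tuple (x # xs) = pair x (tuple xs)"
  by (cases xs) auto

lemma tuple_inject: "length xs = length ys \<Longrightarrow> tuple xs = tuple ys \<longleftrightarrow> xs = ys"
proof (induction xs ys rule: list_induct2)
  case (Cons x xs y ys)
  have "xs = [] \<longleftrightarrow> ys = []"
    using Cons.hyps by auto
  then show ?case
    using Cons.IH by (cases "xs = []") (simp_all add: tuple_Cons pair_inject)
qed simp

lemma product_singleton: "product [S] = S"
proof -
  have "listset [S] = (\<lambda>s. [s]) ` S" by (auto simp: set_Cons_def)
  then show ?thesis by (simp add: product_def image_image)
qed

lemma product_Cons:
  assumes "Ss \<noteq> []"
  shows "product (S # Ss) = {pair a b |a b. a \<in> S \<and> b \<in> product Ss}"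
proof -
  have tuple_eq: "tuple (x # xs) = pair x (tuple xs)" if "xs \<in> listset Ss" for x xs
    using assms length_of_listset[OF that] by (intro tuple_Cons) auto
  have "product (S # Ss) = {tuple (x # xs) |x xs. x \<in> S \<and> xs \<in> listset Ss}"
    by (auto simp: product_def set_Cons_def)
  also have "\<dots> = {pair x (tuple xs) |x xs. x \<in> S \<and> xs \<in> listset Ss}"
    using tuple_eq by (intro Collect_cong) metis
  also have "\<dots> = {pair a b |a b. a \<in> S \<and> b \<in> product Ss}"
    unfolding product_def by blast
  finally show ?thesis .
qed

lemma is_set_product: "\<forall>S \<in> set Ss. is_set S \<Longrightarrow> is_set (product Ss)"
proof (induction Ss)
  case Nil
  then show ?case by (simp add: product_def is_set_singleton)
next
  case (Cons S Ss)
  then show ?case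
    by (cases "Ss = []") (auto simp: product_singleton product_Cons is_set_pairs)
qed

definition tuple_proj :: "nat \<Rightarrow> nat set \<Rightarrow> 'v \<Rightarrow> 'v \<Rightarrow> bool" where
  "tuple_proj n F p q \<longleftrightarrow> (\<exists>ss. length ss = n \<and> p = tuple ss \<and> q = tuple (nths ss F))"

lemma tuple_proj_tuple_iff:
  assumes "length ss = n"
  shows "tuple_proj n F (tuple ss) q \<longleftrightarrow> q = tuple (nths ss F)"
proof
  assume "tuple_proj n F (tuple ss) q"
  then obtain ts where "length ts = n" "tuple ss = tuple ts" "q = tuple (nths ts F)"
    unfolding tuple_proj_def by blast
  then show "q = tuple (nths ss F)"
    using assms by (metis tuple_inject)
qed (use assms in \<open>unfold tuple_proj_def, blast\<close>)

lemma tuple_proj_1: "0 \<in> F \<Longrightarrow> tuple_proj (Suc 0) F p q \<longleftrightarrow> p = q"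
  by (auto simp: tuple_proj_def ex_length_Suc_iff)

lemma tuple_proj_Suc:
  assumes "n > 0" and "\<And>a ss. length ss = n \<Longrightarrow> tuple (nths (a # ss) F) = f a ss"
  shows "tuple_proj (Suc n) F p q \<longleftrightarrow> (\<exists>a ss. length ss = n \<and> p = pair a (tuple ss) \<and> q = f a ss)"
proof -
  have tuple_eq: "tuple (a # ss) = pair a (tuple ss)" if "length ss = n" for a ss
    using assms(1) that by (intro tuple_Cons) auto
  have "tuple_proj (Suc n) F p q \<longleftrightarrow>
      (\<exists>a ss. length ss = n \<and> p = tuple (a # ss) \<and> q = tuple (nths (a # ss) F))"
    by (simp only: tuple_proj_def ex_length_Suc_iff)
  also have "\<dots> \<longleftrightarrow> (\<exists>a ss. length ss = n \<and> p = pair a (tuple ss) \<and> q = f a ss)"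
    by (intro iff_exI conj_cong) (simp_all add: tuple_eq assms(2))
  finally show ?thesis .
qed

lemma tuple_proj_Suc_skip:
  assumes "0 \<notin> F" and "n > 0"
  shows "tuple_proj (Suc n) F p q \<longleftrightarrow> (\<exists>a b. p = pair a b \<and> tuple_proj n {k. Suc k \<in> F} b q)"
proof -
  have "tuple_proj (Suc n) F p q \<longleftrightarrow>
      (\<exists>a ss. length ss = n \<and> p = pair a (tuple ss) \<and> q = tuple (nths ss {k. Suc k \<in> F}))"
    using assms by (intro tuple_proj_Suc) (simp_all add: nths_Cons)
  then show ?thesis unfolding tuple_proj_def by blast
qed

lemma tuple_proj_Suc_head:
  assumes "0 \<in> F" and "n > 0" and "{k. Suc k \<in> F} \<inter> {..<n} = {}"
  shows "tuple_proj (Suc n) F p q \<longleftrightarrow> (\<exists>a b. p = pair a b \<and> q = a \<and> tuple_proj n UNIV b b)"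
proof -
  have "tuple (nths (a # ss) F) = a" if "length ss = n" for a ss
    using assms(1,3) that nths_eq_Nil_iff[of ss "{k. Suc k \<in> F}"] by (simp add: nths_Cons)
  with assms(2)
  have "tuple_proj (Suc n) F p q \<longleftrightarrow> (\<exists>a ss. length ss = n \<and> p = pair a (tuple ss) \<and> q = a)"
    by (intro tuple_proj_Suc)
  then show ?thesis by (simp add: tuple_proj_def nths_all) blast
qed

lemma tuple_proj_Suc_keep:
  assumes "0 \<in> F" and "{k. Suc k \<in> F} \<inter> {..<n} \<noteq> {}"
  shows "tuple_proj (Suc n) F p q \<longleftrightarrow>
    (\<exists>a b. p = pair a b \<and> (\<exists>c d. q = pair c d \<and> c = a \<and> tuple_proj n {k. Suc k \<in> F} b d))"
proof -
  have "tuple (nths (a # ss) F) = pair a (tuple (nths ss {k. Suc k \<in> F}))" if "length ss = n" for a ss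
    using assms that nths_eq_Nil_iff[of ss "{k. Suc k \<in> F}"] by (simp add: nths_Cons tuple_Cons)
  moreover have "n > 0" using assms(2) by auto
  ultimately have "tuple_proj (Suc n) F p q \<longleftrightarrow> (\<exists>a ss. length ss = n \<and> p = pair a (tuple ss) \<and>
      q = pair a (tuple (nths ss {k. Suc k \<in> F})))"
    by (intro tuple_proj_Suc)
  then show ?thesis unfolding tuple_proj_def by blast
qed


subsection \<open>Predicates definable by bounded formulas\<close>

definition definable :: "((nat \<Rightarrow> 'v) \<Rightarrow> bool) \<Rightarrow> bool" where
  "definable P \<longleftrightarrow> (\<exists>\<phi>. \<forall>e. sat E e \<phi> \<longleftrightarrow> P e)"

lemma definable_mem: "definable (\<lambda>e. E (e i) (e j))"
  unfolding definable_def by (intro exI[of _ "Mem i j"]) simp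

lemma definable_eq: "definable (\<lambda>e. e i = e j)"
  unfolding definable_def by (intro exI[of _ "Eq i j"]) simp

lemma definable_not:
  assumes "definable P"
  shows "definable (\<lambda>e. \<not> P e)"
proof -
  obtain \<phi> where "\<And>e. sat E e \<phi> \<longleftrightarrow> P e"
    using assms unfolding definable_def by blast
  then show ?thesis
    unfolding definable_def by (intro exI[of _ "Neg \<phi>"]) simp
qed

lemma definable_conj:
  assumes "definable P" and "definable Q"
  shows "definable (\<lambda>e. P e \<and> Q e)"
proof -
  obtain \<phi> \<psi> where "\<And>e. sat E e \<phi> \<longleftrightarrow> P e" "\<And>e. sat E e \<psi> \<longleftrightarrow> Q e"
    using assms unfolding definable_def by blast
  then show ?thesis
    unfolding definable_def by (intro exI[of _ "Conj \<phi> \<psi>"]) simp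
qed

lemma definable_imp:
  assumes "definable P" and "definable Q"
  shows "definable (\<lambda>e. P e \<longrightarrow> Q e)"
  using definable_not[OF definable_conj[OF assms(1) definable_not[OF assms(2)]]] by simp

lemma definable_disj:
  assumes "definable P" and "definable Q"
  shows "definable (\<lambda>e. P e \<or> Q e)"
  using definable_imp[OF definable_not[OF assms(1)] assms(2)] by (simp add: disj_imp)

lemma definable_ball:
  assumes "definable P"
  shows "definable (\<lambda>e. \<forall>y. E y (e j) \<longrightarrow> P (e(i := y)))"
proof -
  obtain \<phi> where "\<And>e. sat E e \<phi> \<longleftrightarrow> P e"
    using assms unfolding definable_def by blast
  then show ?thesis
    unfolding definable_def by (intro exI[of _ "BAll i j \<phi>"]) simp
qed

lemma definable_bex:
  assumes "definable P"
  shows "definable (\<lambda>e. \<exists>y. E y (e j) \<and> P (e(i := y)))"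
  using definable_not[OF definable_ball[OF definable_not[OF assms]], of j i] by simp

lemma definable_doubleton: "definable (\<lambda>e. e v = as_elem {e a, e b})"
proof -
  define w where "w = Suc (a + b + v)"
  have "definable (\<lambda>e. e w = e a \<or> e w = e b)"
    by (intro definable_disj definable_eq)
  from definable_ball[OF this, of v w]
  have "definable (\<lambda>e. \<forall>y. E y (e v) \<longrightarrow> y = e a \<or> y = e b)"
    by (simp add: w_def)
  then show ?thesis
    unfolding eq_doubleton_iff by (intro definable_conj definable_mem)
qed

lemma definable_pair: "definable (\<lambda>e. e p = pair (e a) (e b))"
proof -
  define u v where "u = Suc (a + b + p)" and "v = Suc u"
  have "definable (\<lambda>e. e u = as_elem {e a, e a} \<and> e v = as_elem {e a, e b} \<and> e p = as_elem {e u, e v})"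
    by (intro definable_conj definable_doubleton)
  from definable_bex[OF definable_bex[OF this, of p v], of p u]
  have "definable (\<lambda>e. \<exists>x. E x (e p) \<and> (\<exists>y. E y (e p) \<and>
      x = as_elem {e a, e a} \<and> y = as_elem {e a, e b} \<and> e p = as_elem {x, y}))"
    by (simp add: u_def v_def)
  moreover have "(\<exists>x. E x z \<and> (\<exists>y. E y z \<and>
      x = as_elem {c, c} \<and> y = as_elem {c, d} \<and> z = as_elem {x, y})) \<longleftrightarrow> z = pair c d" for z c d
    unfolding pair_eq_doubleton by (auto simp: mem_doubleton_iff)
  ultimately show ?thesis by simp
qed

text \<open>The components of \<open>p = {{a}, {a, b}}\<close> are elements of its element \<open>{a, b}\<close>, so the
  quantifiers over them are bounded. Variable \<open>j\<close> first carries \<open>{a, b}\<close> and then \<open>b\<close>.\<close>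

lemma definable_ex_pair:
  assumes "definable P" and "distinct [i, j, p]"
  shows "definable (\<lambda>e. \<exists>a b. e p = pair a b \<and> P (e(i := a, j := b)))"
proof -
  have "definable (\<lambda>e. e p = pair (e i) (e j) \<and> P e)"
    by (intro definable_conj definable_pair assms(1))
  from definable_bex[OF definable_bex[OF definable_bex[OF this, of j j], of j i], of p j]
  have "definable (\<lambda>e. \<exists>u. E u (e p) \<and> (\<exists>a. E a u \<and> (\<exists>b. E b u \<and>
      e p = pair a b \<and> P (e(i := a, j := b)))))"
    using assms(2) by (simp add: fun_upd_twist)
  moreover have "(\<exists>u. E u z \<and> (\<exists>a. E a u \<and> (\<exists>b. E b u \<and> z = pair a b \<and> Q a b))) \<longleftrightarrow>
      (\<exists>a b. z = pair a b \<and> Q a b)" for z Q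
    unfolding pair_eq_doubleton by (metis mem_doubleton_iff)
  ultimately show ?thesis by simp
qed

text \<open>No bounded formula distinguishes the empty tuple \<open>{}\<close> from an atom, hence the restriction on
  \<open>F\<close>.\<close>

lemma definable_tuple_proj:
  "F \<inter> {..<n} \<noteq> {} \<Longrightarrow> definable (\<lambda>e. tuple_proj n F (e p) (e q))"
proof (induction n arbitrary: F p q)
  case (Suc n)
  define i j k l where "i = Suc (p + q)" and "j = Suc i" and "k = Suc j" and "l = Suc k"
  note fresh = i_def j_def k_def l_def
  define G where "G = {k. Suc k \<in> F}"
  consider (skip) "0 \<notin> F" | (single) "0 \<in> F" "n = 0"
    | (head) "0 \<in> F" "n > 0" "G \<inter> {..<n} = {}"
    | (keep) "0 \<in> F" "G \<inter> {..<n} \<noteq> {}" by blast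
  then show ?case
  proof cases
    case skip
    then have G: "G \<inter> {..<n} \<noteq> {}"
      using Suc.prems by (auto simp: G_def less_Suc_eq_0_disj)
    then have "n > 0" by auto
    with definable_ex_pair[OF Suc.IH[OF G, of j q], of i j p] show ?thesis
      using skip by (simp add: tuple_proj_Suc_skip fresh flip: G_def)
  next
    case single
    then show ?thesis by (simp add: tuple_proj_1 definable_eq)
  next
    case head
    have "definable (\<lambda>e. e q = e i \<and> tuple_proj n UNIV (e j) (e j))"
      using head(2) by (intro definable_conj definable_eq Suc.IH) auto
    from definable_ex_pair[OF this, of i j p] show ?thesis
      using head by (simp add: tuple_proj_Suc_head fresh flip: G_def)
  next
    case keep
    have "definable (\<lambda>e. e k = e i \<and> tuple_proj n G (e j) (e l))"
      by (intro definable_conj definable_eq Suc.IH keep(2))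
    from definable_ex_pair[OF definable_ex_pair[OF this, of k l q], of i j p] show ?thesis
      using keep by (simp add: tuple_proj_Suc_keep fresh flip: G_def)
  qed
qed simp


subsection \<open>Cylinders in tensor products\<close>

definition cylinder :: "'v set list \<Rightarrow> nat set \<Rightarrow> 'v set \<Rightarrow> 'v set" where
  "cylinder Ss F A = {tuple ss |ss. ss \<in> listset Ss \<and> tuple (nths ss F) \<in> A}"

lemma cylinder_subset_product: "cylinder Ss F A \<subseteq> product Ss"
  by (auto simp: cylinder_def product_def)

lemma tuple_in_cylinder_iff:
  assumes "ss \<in> listset Ss"
  shows "tuple ss \<in> cylinder Ss F A \<longleftrightarrow> tuple (nths ss F) \<in> A"
proof -
  have "tuple ss = tuple ts \<longleftrightarrow> ss = ts" if "ts \<in> listset Ss" for ts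
    using assms that by (intro tuple_inject) (simp add: length_of_listset)
  then show ?thesis using assms unfolding cylinder_def by blast
qed

lemma cylinder_product_nths: "cylinder Ss F (product (nths Ss F)) = product Ss"
  by (auto simp: cylinder_def product_def nths_in_listset)

lemma iterated_cong:
  "length Us = length Ss \<Longrightarrow> (\<And>ss. ss \<in> listset Ss \<Longrightarrow> P ss \<longleftrightarrow> Q ss) \<Longrightarrow>
     iterated Ss Us P \<longleftrightarrow> iterated Ss Us Q"
proof (induction Us Ss arbitrary: P Q rule: list_induct2)
  case (Cons U Us S Ss)
  have "iterated Ss Us (\<lambda>ss. P (s # ss)) \<longleftrightarrow> iterated Ss Us (\<lambda>ss. Q (s # ss))" if "s \<in> S" for s
    using Cons.prems that by (intro Cons.IH) (auto simp: set_Cons_def)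
  then show ?case by (simp cong: conj_cong)
qed simp

lemma iterated_nths:
  "list_all2 (\<lambda>S U. S \<in> U \<and> {} \<notin> U) Ss Us \<Longrightarrow>
     iterated Ss Us (\<lambda>ss. P (nths ss F)) \<longleftrightarrow> iterated (nths Ss F) (nths Us F) P"
proof (induction Ss Us arbitrary: F P rule: list_all2_induct)
  case (Cons S Ss U Us)
  define G where "G = {j. Suc j \<in> F}"
  have IH: "iterated Ss Us (\<lambda>ss. Q (nths ss G)) \<longleftrightarrow> iterated (nths Ss G) (nths Us G) Q" for Q
    by (rule Cons.IH)
  show ?case
  proof (cases "0 \<in> F")
    case True
    then show ?thesis by (simp add: nths_Cons IH[of "\<lambda>ss. P (_ # ss)"] flip: G_def)
  next
    case False
    then show ?thesis
      using Cons.hyps(1) by (cases "iterated (nths Ss G) (nths Us G) P")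
        (simp_all add: nths_Cons IH flip: G_def)
  qed
qed simp

lemma cylinder_in_tensor_iff:
  assumes "list_all2 (\<lambda>S U. S \<in> U \<and> {} \<notin> U) Ss Us" and "A \<subseteq> product (nths Ss F)"
  shows "cylinder Ss F A \<in> tensor Ss Us \<longleftrightarrow> A \<in> tensor (nths Ss F) (nths Us F)"
proof -
  have "iterated Ss Us (\<lambda>ss. tuple ss \<in> cylinder Ss F A) \<longleftrightarrow>
      iterated Ss Us (\<lambda>ss. tuple (nths ss F) \<in> A)"
    using list_all2_lengthD[OF assms(1)] by (intro iterated_cong) (auto simp: tuple_in_cylinder_iff)
  also have "\<dots> \<longleftrightarrow> iterated (nths Ss F) (nths Us F) (\<lambda>ss. tuple ss \<in> A)"
    using assms(1) by (rule iterated_nths)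
  finally show ?thesis
    using assms(2) by (simp add: tensor_def cylinder_subset_product)
qed

end

context single_superstructure_model
begin

subsection \<open>Nonstandard extensions of sets\<close>

lemma transfer_definable:
  assumes "definable P"
  shows "P e \<longleftrightarrow> P (star \<circ> e)"
proof -
  obtain \<phi> where "\<And>e. sat E e \<phi> \<longleftrightarrow> P e"
    using assms unfolding definable_def by blast
  then show ?thesis
    using transfer[of e \<phi>] by simp
qed

lemma mem_star_iff: "E (star a) (star b) \<longleftrightarrow> E a b"
  using transfer_definable[OF definable_mem[of 0 1], of "(\<lambda>_. b)(0 := a)"] by simp

lemma star_in_star_set_iff: "is_set A \<Longrightarrow> star a \<in> star_set A \<longleftrightarrow> a \<in> A"
  by (simp add: star_set_def mem_star_iff mem_as_elem_iff)

lemma star_in_atoms_iff: "star a \<in> X \<longleftrightarrow> a \<in> X"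
  using star_in_star_set_iff[OF is_set_atoms, of a]
  by (simp add: star_set_def star_base mem_as_elem_iff is_set_atoms)

text \<open>Variable \<open>0\<close> of the definable relation ranges over \<open>Y\<close>, variable \<open>1\<close> carries a parameter.\<close>

lemma star_set_Collect:
  assumes "definable (\<lambda>e. P (e 0) (e 1))" and "is_set Y"
  shows "star_set {y \<in> Y. P y a} = {\<eta> \<in> star_set Y. P \<eta> (star a)}"
proof -
  define B where "B = {y \<in> Y. P y a}"
  define e where "e = (\<lambda>_::nat. a)(2 := as_elem Y, 3 := as_elem B)"
  have B: "is_set B" using assms(2) by (rule is_set_subset) (auto simp: B_def)
  have "definable (\<lambda>e. E (e 0) (e 2) \<and> P (e 0) (e 1))"
    by (intro definable_conj definable_mem assms(1))
  from definable_ball[OF this, of 3 0]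
  have subset: "definable (\<lambda>e. \<forall>y. E y (e 3) \<longrightarrow> E y (e 2) \<and> P y (e 1))" by simp
  have "definable (\<lambda>e. P (e 0) (e 1) \<longrightarrow> E (e 0) (e 3))"
    by (intro definable_imp definable_mem assms(1))
  from definable_ball[OF this, of 2 0]
  have superset: "definable (\<lambda>e. \<forall>y. E y (e 2) \<longrightarrow> P y (e 1) \<longrightarrow> E y (e 3))" by simp
  show ?thesis
    using transfer_definable[OF subset, of e] transfer_definable[OF superset, of e] assms(2) B
    by (auto simp: e_def B_def star_set_def mem_as_elem_iff)
qed

lemma star_set_empty: "star_set {} = {}"
  using star_set_Collect[OF definable_not[OF definable_eq[of 0 0]] is_set_empty] by simp

lemma star_empty: "star (as_elem {}) = as_elem {}"
proof (rule as_elem_eqI)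
  show "star (as_elem {}) \<notin> X"
    by (simp add: star_in_atoms_iff as_elem_notin_atoms is_set_empty)
  show "E x (star (as_elem {})) \<longleftrightarrow> x \<in> {}" for x
    using star_set_empty by (auto simp: star_set_def)
qed (rule is_set_empty)

lemma star_set_preimage:
  assumes "definable (\<lambda>e. R (e 0) (e 1))" and "is_set Y" and "is_set A"
  shows "star_set {y \<in> Y. \<exists>x\<in>A. R y x} = {\<eta> \<in> star_set Y. \<exists>\<xi>\<in>star_set A. R \<eta> \<xi>}"
proof -
  have "definable (\<lambda>e. \<exists>x. E x (e 1) \<and> R (e 0) x)"
    using definable_bex[OF assms(1), of 1 1] by simp
  from star_set_Collect[OF this assms(2), of "as_elem A"] show ?thesis
    using assms(3) by (simp add: mem_as_elem_iff star_set_def Bex_def)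
qed

lemma star_set_cylinder:
  assumes sets: "\<forall>S \<in> set Ss. is_set S" and A: "is_set A"
    and len: "length \<alpha>s = length Ss" and \<alpha>s: "tuple \<alpha>s \<in> star_set (product Ss)"
  shows "tuple \<alpha>s \<in> star_set (cylinder Ss F A) \<longleftrightarrow> tuple (nths \<alpha>s F) \<in> star_set A"
proof (cases "F \<inter> {..<length Ss} = {}")
  case True
  then have "nths ss F = []" if "ss \<in> listset Ss" for ss
    using that by (simp add: nths_eq_Nil_iff length_of_listset)
  then have "cylinder Ss F A = (if as_elem {} \<in> A then product Ss else {})"
    by (auto simp: cylinder_def product_def)
  moreover have "tuple (nths \<alpha>s F) = star (as_elem {})"
    using True len by (simp add: nths_eq_Nil_iff[THEN iffD2] star_empty)
  ultimately show ?thesis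
    using \<alpha>s A by (simp add: star_in_star_set_iff star_set_empty)
next
  case False
  then have "star_set {y \<in> product Ss. \<exists>x\<in>A. tuple_proj (length Ss) F y x} =
      {\<eta> \<in> star_set (product Ss). \<exists>\<xi>\<in>star_set A. tuple_proj (length Ss) F \<eta> \<xi>}"
    by (intro star_set_preimage definable_tuple_proj is_set_product sets A)
  moreover have "cylinder Ss F A = {y \<in> product Ss. \<exists>x\<in>A. tuple_proj (length Ss) F y x}"
    by (auto simp: cylinder_def product_def tuple_proj_tuple_iff length_of_listset)
  ultimately show ?thesis
    using \<alpha>s len by (simp add: tuple_proj_tuple_iff)
qed


subsection \<open>Subtuples of tensor tuples\<close>

lemma tuple_nths_in_star_set_product:
  assumes "\<forall>S \<in> set Ss. is_set S" "length \<alpha>s = length Ss" "tuple \<alpha>s \<in> star_set (product Ss)"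
  shows "tuple (nths \<alpha>s F) \<in> star_set (product (nths Ss F))"
proof -
  have "is_set (product (nths Ss F))"
    using assms(1) by (intro is_set_product) (auto dest: in_set_nthsD)
  from star_set_cylinder[OF assms(1) this assms(2,3), of F] show ?thesis
    using assms(3) by (simp add: cylinder_product_nths)
qed

lemma component_in_star_set:
  assumes "\<forall>S \<in> set Ss. is_set S" "length \<alpha>s = length Ss" "tuple \<alpha>s \<in> star_set (product Ss)"
    and "i < length Ss"
  shows "\<alpha>s ! i \<in> star_set (Ss ! i)"
  using tuple_nths_in_star_set_product[OF assms(1-3), of "{i}"] assms(2,4)
  by (simp add: nths_index_singleton product_singleton)

lemma tensor_tuple_nths:
  assumes sets: "\<forall>S \<in> set Ss. is_set S" and tensor: "tensor_tuple Ss \<alpha>s"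
  shows "tensor_tuple (nths Ss F) (nths \<alpha>s F)"
proof -
  have len: "length \<alpha>s = length Ss" and \<alpha>s: "tuple \<alpha>s \<in> star_set (product Ss)"
    using tensor by (simp_all add: tensor_tuple_def)
  define Us where "Us = map2 generated_ultrafilter Ss \<alpha>s"
  have Us_proper: "list_all2 (\<lambda>S U. S \<in> U \<and> {} \<notin> U) Ss Us"
    using component_in_star_set[OF sets len \<alpha>s] len
    by (simp add: list_all2_conv_all_nth Us_def generated_ultrafilter_def star_set_empty)
  have "A \<in> generated_ultrafilter (product (nths Ss F)) (tuple (nths \<alpha>s F)) \<longleftrightarrow>
      A \<in> tensor (nths Ss F) (nths Us F)" if A: "A \<subseteq> product (nths Ss F)" for A
  proof -
    have "is_set A"
      using sets A by (intro is_set_subset[OF is_set_product A]) (auto dest: in_set_nthsD)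
    then have "A \<in> generated_ultrafilter (product (nths Ss F)) (tuple (nths \<alpha>s F)) \<longleftrightarrow>
        cylinder Ss F A \<in> generated_ultrafilter (product Ss) (tuple \<alpha>s)"
      using A star_set_cylinder[OF sets _ len \<alpha>s]
      by (simp add: generated_ultrafilter_def cylinder_subset_product)
    also have "\<dots> \<longleftrightarrow> cylinder Ss F A \<in> tensor Ss Us"
      using tensor by (simp add: tensor_tuple_def Us_def)
    also have "\<dots> \<longleftrightarrow> A \<in> tensor (nths Ss F) (nths Us F)"
      using Us_proper A by (rule cylinder_in_tensor_iff)
    finally show ?thesis .
  qed
  then have "generated_ultrafilter (product (nths Ss F)) (tuple (nths \<alpha>s F)) =
      tensor (nths Ss F) (nths Us F)"
    by (auto simp: generated_ultrafilter_def tensor_def)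
  moreover have "nths Us F = map2 generated_ultrafilter (nths Ss F) (nths \<alpha>s F)"
    by (simp add: Us_def nths_map nths_zip)
  ultimately show ?thesis
    using len tuple_nths_in_star_set_product[OF sets len \<alpha>s]
    by (simp add: tensor_tuple_def length_nths)
qed

end

theorem theorem4p28:
  fixes X :: "'v set" and E :: "'v \<Rightarrow> 'v \<Rightarrow> bool" and star :: "'v \<Rightarrow> 'v"
    and k :: nat and Ss :: "'v set list" and \<alpha>s :: "'v list"
  assumes "single_superstructure_model X E star"
    and "k \<ge> 1"
    and "length Ss = k + 1"
    and "\<forall>S \<in> set Ss. superstructure.is_set X E S"
    and "length \<alpha>s = k + 1"
    and "superstructure.tuple X E \<alpha>s \<in>
           single_superstructure_model.star_set X E star (superstructure.product X E Ss)"
  shows "single_superstructure_model.tensor_tuple X E star Ss \<alpha>s \<longleftrightarrow>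
         (\<forall>F \<subseteq> {0..k}. single_superstructure_model.tensor_tuple X E star (nths Ss F) (nths \<alpha>s F))"
proof -
  interpret single_superstructure_model X E star by (rule assms(1))
  have nths_whole: "nths Ss {0..k} = Ss" "nths \<alpha>s {0..k} = \<alpha>s"
    using assms(3,5) by (auto intro!: nths_all)
  show ?thesis
  proof
    assume "tensor_tuple Ss \<alpha>s"
    then show "\<forall>F \<subseteq> {0..k}. tensor_tuple (nths Ss F) (nths \<alpha>s F)"
      using tensor_tuple_nths[OF assms(4)] by blast
  next
    assume "\<forall>F \<subseteq> {0..k}. tensor_tuple (nths Ss F) (nths \<alpha>s F)"
    then have "tensor_tuple (nths Ss {0..k}) (nths \<alpha>s {0..k})" by blast
    then show "tensor_tuple Ss \<alpha>s" by (simp add: nths_whole)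
  qed
qed

end
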